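(* Let $G$ be a topological group and let $\alpha$ be a partial action of $G$ on a topological space $X$. Then there exists a pair $(\iota,\alpha^{e})$ such that $\alpha^{e}$ is a continuous (global) action of $G$ on a topological space $X^{e}$ and $\iota:\alpha\to\alpha^{e}$ is a morphism, with the following universal property: for any morphism $\psi:\alpha\to\beta$, where $\beta$ is a continuous (global) action of $G$ on a topological space, there exists a unique morphism $\psi^{e}:\alpha^{e}\to\beta$ such that $\psi^{e}\circ\iota=\psi$. Moreover, the pair $(\iota,\alpha^{e})$ is unique up to canonical isomorphism, and: (1) $\iota(X)$ is open in $X^{e}$; (2) $\iota:X\to\iota(X)$ is a homeomorphism; (3) $X^{e}$ is the $\alpha^{e}$-orbit of $\iota(X)$, i.e. $X^{e}=\bigcup_{t\in G}\alpha^{e}_t(\iota(X))$.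
   Context: A partial action of a topological group $G$ on a topological space $X$ is a pair $\alpha=(\{X_t\}_{t\in G},\{\alpha_t\}_{t\in G})$ such that: (i) each $X_t$ is open in $X$ and $\alpha_t:X_{t^{-1}}\to X_t$ is a homeomorphism; (ii) the set $\Gamma_\alpha=\{(t,x)\in G\times X: x\in X_{t^{-1}}\}$ is open in $G\times X$ and the map $\Gamma_\alpha\to X$, $(t,x)\mapsto\alpha_t(x)$, is continuous; (iii) $X_e=X$, and $\alpha_{st}$ is an extension of $\alpha_s\alpha_t$ for all $s,t\in G$ (where $\alpha_s\alpha_t$ has domain $\{x\in X_{t^{-1}}:\alpha_t(x)\in X_{s^{-1}}\}$). A continuous global action is regarded as a partial action with $X_t=X$ for all $t$. If $\alpha=(\{X_t\},\{\alpha_t\})$ and $\beta=(\{Y_t\},\{\beta_t\})$ are partial actions of $G$ on $X$ and $Y$, a morphism $\phi:\alpha\to\beta$ is a continuous map $\phi:X\to Y$ such that $\phi(X_t)\subseteq Y_t$ and $\phi(\alpha_t(x))=\beta_t(\phi(x))$ for all $t\in G$, $x\in X_{t^{-1}}$. *)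

theory Defs
  imports "HOL-Analysis.Analysis"
begin

text \<open>
  The topological group is a type of class \<^class>\<open>topological_group_add\<close>. This class requires neither
  commutativity nor the Hausdorff property; the group is only written additively, so that
  $e$, $st$ and $t^{-1}$ become \<open>0\<close>, \<open>s + t\<close> and \<open>- t\<close>.
\<close>

record ('g, 'x) paction =
  pspace :: "'x topology"
  pdom :: "'g \<Rightarrow> 'x set"
  pmap :: "'g \<Rightarrow> 'x \<Rightarrow> 'x"

abbreviation pcarrier :: "('g, 'x) paction \<Rightarrow> 'x set" where
  "pcarrier \<alpha> \<equiv> topspace (pspace \<alpha>)"

definition pgraph :: "('g::topological_group_add, 'x) paction \<Rightarrow> ('g \<times> 'x) set" where
  "pgraph \<alpha> = {(t, x). x \<in> pdom \<alpha> (- t)}"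

definition partial_action :: "('g::topological_group_add, 'x) paction \<Rightarrow> bool" where
  "partial_action \<alpha> \<longleftrightarrow>
     (\<forall>t. openin (pspace \<alpha>) (pdom \<alpha> t)) \<and>
     (\<forall>t. homeomorphic_map (subtopology (pspace \<alpha>) (pdom \<alpha> (- t)))
            (subtopology (pspace \<alpha>) (pdom \<alpha> t)) (pmap \<alpha> t)) \<and>
     openin (prod_topology euclidean (pspace \<alpha>)) (pgraph \<alpha>) \<and>
     continuous_map (subtopology (prod_topology euclidean (pspace \<alpha>)) (pgraph \<alpha>)) (pspace \<alpha>)
       (\<lambda>(t, x). pmap \<alpha> t x) \<and>
     pdom \<alpha> 0 = pcarrier \<alpha> \<and>
     (\<forall>s t. \<forall>x \<in> pdom \<alpha> (- t). pmap \<alpha> t x \<in> pdom \<alpha> (- s) \<longrightarrow>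
        x \<in> pdom \<alpha> (- (s + t)) \<and> pmap \<alpha> (s + t) x = pmap \<alpha> s (pmap \<alpha> t x))"

definition global_action :: "('g::topological_group_add, 'x) paction \<Rightarrow> bool" where
  "global_action \<alpha> \<longleftrightarrow> partial_action \<alpha> \<and> (\<forall>t. pdom \<alpha> t = pcarrier \<alpha>)"

text \<open>A partial action with full domains is exactly a continuous action in the usual sense.\<close>

lemma global_action_iff:
  "global_action \<alpha> \<longleftrightarrow>
     (\<forall>t. pdom \<alpha> t = pcarrier \<alpha>) \<and>
     continuous_map (prod_topology euclidean (pspace \<alpha>)) (pspace \<alpha>) (\<lambda>(t, x). pmap \<alpha> t x) \<and>
     (\<forall>x \<in> pcarrier \<alpha>. pmap \<alpha> 0 x = x) \<and>
     (\<forall>s t. \<forall>x \<in> pcarrier \<alpha>. pmap \<alpha> (s + t) x = pmap \<alpha> s (pmap \<alpha> t x))"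
  (is "?L \<longleftrightarrow> ?R")
proof
  assume L: ?L
  then have full: "pdom \<alpha> t = pcarrier \<alpha>" for t
    by (simp add: global_action_def)
  have g: "pgraph \<alpha> = topspace (prod_topology euclidean (pspace \<alpha>))"
    by (auto simp: pgraph_def full)
  have st: "subtopology (prod_topology euclidean (pspace \<alpha>)) (pgraph \<alpha>) =
      prod_topology euclidean (pspace \<alpha>)"
    unfolding g by (rule subtopology_topspace)
  have hm: "homeomorphic_map (pspace \<alpha>) (pspace \<alpha>) (pmap \<alpha> t)" for t
    using L by (simp add: global_action_def partial_action_def full)
  have c: "continuous_map (prod_topology euclidean (pspace \<alpha>)) (pspace \<alpha>) (\<lambda>(t, x). pmap \<alpha> t x)"
    using L by (simp add: global_action_def partial_action_def st)
  have into: "pmap \<alpha> t x \<in> pcarrier \<alpha>" if "x \<in> pcarrier \<alpha>" for t x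
    using hm[of t] that homeomorphic_imp_surjective_map by blast
  have m: "pmap \<alpha> (s + t) x = pmap \<alpha> s (pmap \<alpha> t x)" if "x \<in> pcarrier \<alpha>" for s t x
    using L that into by (simp add: global_action_def partial_action_def full)
  have "pmap \<alpha> 0 x = x" if "x \<in> pcarrier \<alpha>" for x
    using m[of x 0 0] that into[of x 0] homeomorphic_imp_injective_map[OF hm[of 0]]
    by (simp add: inj_on_def)
  with full c m show ?R by blast
next
  assume R: ?R
  then have full: "pdom \<alpha> t = pcarrier \<alpha>" for t by simp
  have g: "pgraph \<alpha> = topspace (prod_topology euclidean (pspace \<alpha>))"
    by (auto simp: pgraph_def full)
  have st: "subtopology (prod_topology euclidean (pspace \<alpha>)) (pgraph \<alpha>) =
      prod_topology euclidean (pspace \<alpha>)"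
    unfolding g by (rule subtopology_topspace)
  have c: "continuous_map (prod_topology euclidean (pspace \<alpha>)) (pspace \<alpha>) (\<lambda>(t, x). pmap \<alpha> t x)"
    using R by blast
  have ct: "continuous_map (pspace \<alpha>) (pspace \<alpha>) (pmap \<alpha> t)" for t
  proof -
    have "continuous_map (pspace \<alpha>) (prod_topology euclidean (pspace \<alpha>)) (\<lambda>x. (t, x))"
      by (simp add: continuous_map_pairedI)
    from continuous_map_compose[OF this c] show ?thesis by (simp add: o_def)
  qed
  have "pmap \<alpha> (- t) (pmap \<alpha> t x) = x" "pmap \<alpha> t (pmap \<alpha> (- t) x) = x"
    if "x \<in> pcarrier \<alpha>" for t x
    using R that by (metis left_minus, metis right_minus)
  then have "homeomorphic_maps (pspace \<alpha>) (pspace \<alpha>) (pmap \<alpha> t) (pmap \<alpha> (- t))" for t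
    by (simp add: homeomorphic_maps_def ct)
  then have "homeomorphic_map (pspace \<alpha>) (pspace \<alpha>) (pmap \<alpha> t)" for t
    using homeomorphic_map_maps by blast
  moreover have "openin (prod_topology euclidean (pspace \<alpha>)) (pgraph \<alpha>)"
    unfolding g by blast
  moreover have "continuous_map (subtopology (prod_topology euclidean (pspace \<alpha>)) (pgraph \<alpha>))
      (pspace \<alpha>) (\<lambda>(t, x). pmap \<alpha> t x)"
    using c by (simp add: st)
  ultimately show ?L
    using R by (simp add: global_action_def partial_action_def)
qed

definition morphism ::
  "('g::topological_group_add, 'x) paction \<Rightarrow> ('g, 'y) paction \<Rightarrow> ('x \<Rightarrow> 'y) \<Rightarrow> bool" where
  "morphism \<alpha> \<beta> \<phi> \<longleftrightarrow>
     continuous_map (pspace \<alpha>) (pspace \<beta>) \<phi> \<and>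
     (\<forall>t. \<phi> ` pdom \<alpha> t \<subseteq> pdom \<beta> t) \<and>
     (\<forall>t. \<forall>x \<in> pdom \<alpha> (- t). \<phi> (pmap \<alpha> t x) = pmap \<beta> t (\<phi> x))"

definition isomorphism ::
  "('g::topological_group_add, 'x) paction \<Rightarrow> ('g, 'y) paction \<Rightarrow> ('x \<Rightarrow> 'y) \<Rightarrow> bool" where
  "isomorphism \<alpha> \<beta> \<phi> \<longleftrightarrow>
     morphism \<alpha> \<beta> \<phi> \<and>
     (\<exists>\<psi>. morphism \<beta> \<alpha> \<psi> \<and>
        (\<forall>x \<in> pcarrier \<alpha>. \<psi> (\<phi> x) = x) \<and> (\<forall>y \<in> pcarrier \<beta>. \<phi> (\<psi> y) = y))"

text \<open>
  The universal property of \<open>(\<iota>, \<alpha>e)\<close>, tested against all continuous global actions \<open>\<beta>\<close> whose space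
  lives on the type \<open>'y\<close> (HOL cannot quantify over \<open>'y\<close> inside a formula). Maps are total
  functions, so equality of maps means agreement on the carrier of the source.
\<close>

definition universal_pair ::
  "'y itself \<Rightarrow> ('g::topological_group_add, 'x) paction \<Rightarrow> ('x \<Rightarrow> 'e) \<Rightarrow> ('g, 'e) paction \<Rightarrow> bool" where
  "universal_pair (_ :: 'y itself) \<alpha> \<iota> \<alpha>e \<longleftrightarrow>
     global_action \<alpha>e \<and> morphism \<alpha> \<alpha>e \<iota> \<and>
     (\<forall>(\<beta> :: ('g, 'y) paction) \<psi>. global_action \<beta> \<and> morphism \<alpha> \<beta> \<psi> \<longrightarrow>
        (\<exists>\<psi>e. morphism \<alpha>e \<beta> \<psi>e \<and> (\<forall>x \<in> pcarrier \<alpha>. \<psi>e (\<iota> x) = \<psi> x) \<and>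
           (\<forall>\<eta>. morphism \<alpha>e \<beta> \<eta> \<and> (\<forall>x \<in> pcarrier \<alpha>. \<eta> (\<iota> x) = \<psi> x) \<longrightarrow>
              (\<forall>z \<in> pcarrier \<alpha>e. \<eta> z = \<psi>e z))))"

end

theory Submission
  imports Defs
begin

text \<open>
  The enveloping space is the quotient of $G \times X$ in which $(r, x)$ is identified with
  $(r g^{-1}, \alpha_g(x))$ whenever $x \in X_{g^{-1}}$, and $G$ acts by left translation of the first
  coordinate. The saturation of an open set is the union over $g$ of its preimages under the
  partial homeomorphisms $(s, y) \mapsto (s g^{-1}, \alpha_g(y))$, so the quotient map is open. Openness
  survives taking the product with $G$, and this makes the action on the quotient jointly
  continuous although $G$ need not be locally compact. The canonical map $x \mapsto [e, x]$ is open
  because the preimage of the image of $U$ is $\{(s, y) : y \in X_{s^{-1}}, \alpha_s(y) \in U\}$, which is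
  open by the joint continuity of $\alpha$. Every other universal pair is isomorphic to this one and
  inherits its properties.
\<close>

section \<open>Quotient topologies and open maps\<close>

text \<open>The final topology along \<open>f\<close>, carried by the image of \<open>f\<close> and
  not by the whole type. Without the bound on \<open>U\<close>, sets that miss the image would count
  as open as well.\<close>

definition quotient_topology :: "'a topology \<Rightarrow> ('a \<Rightarrow> 'b) \<Rightarrow> 'b topology" where
  "quotient_topology X f =
     topology (\<lambda>U. U \<subseteq> f ` topspace X \<and> openin X {x \<in> topspace X. f x \<in> U})"

lemma openin_quotient_topology:
  "openin (quotient_topology X f) U \<longleftrightarrow>
     U \<subseteq> f ` topspace X \<and> openin X {x \<in> topspace X. f x \<in> U}"
proof -
  have "istopology (\<lambda>U. U \<subseteq> f ` topspace X \<and> openin X {x \<in> topspace X. f x \<in> U})"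
    unfolding istopology_def
  proof (intro conjI allI impI)
    fix S T
    assume S: "S \<subseteq> f ` topspace X \<and> openin X {x \<in> topspace X. f x \<in> S}"
      and T: "T \<subseteq> f ` topspace X \<and> openin X {x \<in> topspace X. f x \<in> T}"
    have "{x \<in> topspace X. f x \<in> S \<inter> T} =
        {x \<in> topspace X. f x \<in> S} \<inter> {x \<in> topspace X. f x \<in> T}"
      by blast
    with S T show "openin X {x \<in> topspace X. f x \<in> S \<inter> T}"
      by (simp only: openin_Int)
    show "S \<inter> T \<subseteq> f ` topspace X"
      using S by blast
  next
    fix \<K>
    assume K: "\<forall>K\<in>\<K>. K \<subseteq> f ` topspace X \<and> openin X {x \<in> topspace X. f x \<in> K}"
    have "{x \<in> topspace X. f x \<in> \<Union>\<K>} = (\<Union>K\<in>\<K>. {x \<in> topspace X. f x \<in> K})"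
      by blast
    moreover have "openin X (\<Union>K\<in>\<K>. {x \<in> topspace X. f x \<in> K})"
      using K by blast
    ultimately show "openin X {x \<in> topspace X. f x \<in> \<Union>\<K>}"
      by (simp only:)
    show "\<Union>\<K> \<subseteq> f ` topspace X"
      using K by blast
  qed
  then show ?thesis
    by (simp add: quotient_topology_def)
qed

lemma topspace_quotient_topology [simp]: "topspace (quotient_topology X f) = f ` topspace X"
proof -
  have "{x \<in> topspace X. f x \<in> f ` topspace X} = topspace X"
    by blast
  then have "openin (quotient_topology X f) (f ` topspace X)"
    by (simp add: openin_quotient_topology)
  then have "f ` topspace X \<subseteq> topspace (quotient_topology X f)"
    by (rule openin_subset)
  moreover have "topspace (quotient_topology X f) \<subseteq> f ` topspace X"
    using openin_topspace openin_quotient_topology by fast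
  ultimately show ?thesis
    by blast
qed

lemma quotient_map_quotient_topology: "quotient_map X (quotient_topology X f) f"
  by (simp add: quotient_map_def openin_quotient_topology)

text \<open>Products of quotient maps can fail to be quotient maps, whereas openness can be checked
  on basic rectangles and so passes to products. This is applied below to the identity of
  \<open>G\<close> and the map onto the envelope.\<close>

lemma open_map_prod_top:
  assumes "open_map X X' f" "open_map Y Y' g"
  shows "open_map (prod_topology X Y) (prod_topology X' Y') (\<lambda>(x, y). (f x, g y))"
  unfolding open_map_def
proof (intro allI impI)
  fix W assume W: "openin (prod_topology X Y) W"
  show "openin (prod_topology X' Y') ((\<lambda>(x, y). (f x, g y)) ` W)"
    unfolding openin_prod_topology_alt
  proof (intro allI impI)
    fix a b assume "(a, b) \<in> (\<lambda>(x, y). (f x, g y)) ` W"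
    then obtain x y where xy: "(x, y) \<in> W" "a = f x" "b = g y" by auto
    then obtain U V where UV: "openin X U" "openin Y V" "x \<in> U" "y \<in> V" "U \<times> V \<subseteq> W"
      using W unfolding openin_prod_topology_alt by meson
    show "\<exists>U V. openin X' U \<and> openin Y' V \<and> a \<in> U \<and> b \<in> V \<and>
        U \<times> V \<subseteq> (\<lambda>(x, y). (f x, g y)) ` W"
    proof (intro exI conjI)
      show "openin X' (f ` U)" "openin Y' (g ` V)"
        using assms UV by (auto simp: open_map_def)
      show "f ` U \<times> g ` V \<subseteq> (\<lambda>(x, y). (f x, g y)) ` W"
        unfolding image_paired_Times[symmetric] using UV(5) by (rule image_mono)
    qed (use xy UV in auto)
  qed
qed

text \<open>The type class states continuity of addition on the product type;
  \<open>prod_topology_euclidean\<close> links this to the product of abstract topologies.\<close>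

lemma continuous_map_plus:
  fixes f g :: "'a \<Rightarrow> 'b::topological_monoid_add"
  assumes "continuous_map X euclidean f" "continuous_map X euclidean g"
  shows "continuous_map X euclidean (\<lambda>x. f x + g x)"
proof -
  have "continuous_map X (prod_topology euclidean euclidean) (\<lambda>x. (f x, g x))"
    using assms by (rule continuous_map_pairedI)
  then have "continuous_map X euclidean (\<lambda>x. (f x, g x))"
    by (simp only: prod_topology_euclidean)
  moreover have "continuous_map euclidean euclidean (\<lambda>p. fst p + snd p :: 'b)"
    unfolding continuous_map_iff_continuous2 by (intro continuous_intros)
  ultimately have "continuous_map X euclidean ((\<lambda>p. fst p + snd p) \<circ> (\<lambda>x. (f x, g x)))"
    by (rule continuous_map_compose)
  then show ?thesis
    by (simp add: o_def)
qed

section \<open>Partial actions and morphisms\<close>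

lemma partial_action_dom_subset: "partial_action \<alpha> \<Longrightarrow> pdom \<alpha> t \<subseteq> pcarrier \<alpha>"
  by (simp add: partial_action_def openin_subset)

lemma partial_action_dom_zero: "partial_action \<alpha> \<Longrightarrow> pdom \<alpha> 0 = pcarrier \<alpha>"
  by (simp add: partial_action_def)

lemma partial_action_image: "partial_action \<alpha> \<Longrightarrow> pmap \<alpha> t ` pdom \<alpha> (- t) = pdom \<alpha> t"
  using homeomorphic_imp_surjective_map[of "subtopology (pspace \<alpha>) (pdom \<alpha> (- t))"
      "subtopology (pspace \<alpha>) (pdom \<alpha> t)" "pmap \<alpha> t"]
  by (simp only: topspace_subtopology_subset[OF partial_action_dom_subset])
    (simp add: partial_action_def)

lemma partial_action_mem: "partial_action \<alpha> \<Longrightarrow> x \<in> pdom \<alpha> (- t) \<Longrightarrow> pmap \<alpha> t x \<in> pdom \<alpha> t"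
  using partial_action_image by blast

lemma partial_action_add:
  assumes "partial_action \<alpha>" "x \<in> pdom \<alpha> (- t)" "pmap \<alpha> t x \<in> pdom \<alpha> (- s)"
  shows "x \<in> pdom \<alpha> (- (s + t))" "pmap \<alpha> (s + t) x = pmap \<alpha> s (pmap \<alpha> t x)"
proof -
  have "\<forall>s t. \<forall>x \<in> pdom \<alpha> (- t). pmap \<alpha> t x \<in> pdom \<alpha> (- s) \<longrightarrow>
      x \<in> pdom \<alpha> (- (s + t)) \<and> pmap \<alpha> (s + t) x = pmap \<alpha> s (pmap \<alpha> t x)"
    using assms(1) unfolding partial_action_def by (elim conjE)
  then show "x \<in> pdom \<alpha> (- (s + t))" "pmap \<alpha> (s + t) x = pmap \<alpha> s (pmap \<alpha> t x)"
    using assms(2,3) by simp_all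
qed

text \<open>The definition does not list this law. It follows because \<alpha>_0 is injective and
  idempotent: the composition law for 0 + 0 gives \<alpha>_0(\<alpha>_0(x)) = \<alpha>_0(x), and one
  \<alpha>_0 cancels.\<close>

lemma partial_action_zero:
  assumes "partial_action \<alpha>" "x \<in> pcarrier \<alpha>"
  shows "pmap \<alpha> 0 x = x"
proof -
  have hm: "homeomorphic_map (pspace \<alpha>) (pspace \<alpha>) (pmap \<alpha> 0)"
    using assms(1) partial_action_dom_zero[OF assms(1)]
    by (metis minus_zero partial_action_def subtopology_topspace)
  have d: "pdom \<alpha> (- 0) = pcarrier \<alpha>"
    by (simp add: partial_action_dom_zero assms(1))
  have m: "pmap \<alpha> 0 x \<in> pcarrier \<alpha>"
    using partial_action_mem[OF assms(1), of x 0] assms d by simp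
  have "pmap \<alpha> (0 + 0) x = pmap \<alpha> 0 (pmap \<alpha> 0 x)"
    by (rule partial_action_add(2)) (use assms d m in auto)
  then show ?thesis
    using homeomorphic_imp_injective_map[OF hm] assms(2) m by (simp add: inj_on_def)
qed

lemma partial_action_inverse:
  assumes "partial_action \<alpha>" "x \<in> pdom \<alpha> (- t)"
  shows "pmap \<alpha> (- t) (pmap \<alpha> t x) = x"
proof -
  have "pmap \<alpha> (- t + t) x = pmap \<alpha> (- t) (pmap \<alpha> t x)"
    by (rule partial_action_add(2)) (use assms partial_action_mem in auto)
  then show ?thesis
    using partial_action_zero[OF assms(1), of x] partial_action_dom_subset[OF assms(1)] assms(2)
    by auto
qed

lemma global_action_dom: "global_action \<alpha> \<Longrightarrow> pdom \<alpha> t = pcarrier \<alpha>"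
  by (simp add: global_action_def)

lemma morphism_mem: "morphism \<alpha> \<beta> \<phi> \<Longrightarrow> x \<in> pcarrier \<alpha> \<Longrightarrow> \<phi> x \<in> pcarrier \<beta>"
  unfolding morphism_def using continuous_map_funspace by blast

lemma morphism_equivariant:
  "morphism \<alpha> \<beta> \<phi> \<Longrightarrow> x \<in> pdom \<alpha> (- t) \<Longrightarrow> \<phi> (pmap \<alpha> t x) = pmap \<beta> t (\<phi> x)"
  by (simp add: morphism_def)

lemma morphism_ident: "morphism \<alpha> \<alpha> (\<lambda>x. x)"
  by (simp add: morphism_def)

lemma morphism_compose:
  assumes "morphism \<alpha> \<beta> \<phi>" "morphism \<beta> \<gamma> \<psi>"
  shows "morphism \<alpha> \<gamma> (\<lambda>x. \<psi> (\<phi> x))"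
  unfolding morphism_def
proof (intro conjI allI ballI)
  show "continuous_map (pspace \<alpha>) (pspace \<gamma>) (\<lambda>x. \<psi> (\<phi> x))"
    using continuous_map_compose[of "pspace \<alpha>" "pspace \<beta>" \<phi> "pspace \<gamma>" \<psi>] assms
    by (simp add: morphism_def o_def)
  have dom: "\<phi> x \<in> pdom \<beta> t" if "x \<in> pdom \<alpha> t" for x t
    using assms(1) that unfolding morphism_def by blast
  then show "(\<lambda>x. \<psi> (\<phi> x)) ` pdom \<alpha> t \<subseteq> pdom \<gamma> t" for t
    using assms(2) unfolding morphism_def by blast
  show "\<psi> (\<phi> (pmap \<alpha> t x)) = pmap \<gamma> t (\<psi> (\<phi> x))" if "x \<in> pdom \<alpha> (- t)" for t x
    using morphism_equivariant[OF assms(1) that] morphism_equivariant[OF assms(2) dom[OF that]]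
    by simp
qed

text \<open>Equivariance determines the value at a translate of \<open>x\<close> from the value at
  \<open>x\<close>. This yields the uniqueness half of the universal property of the
  envelope.\<close>

lemma morphism_agree_on_orbit:
  assumes "global_action \<alpha>" "morphism \<alpha> \<beta> \<phi>" "morphism \<alpha> \<beta> \<psi>"
    and "S \<subseteq> pcarrier \<alpha>" "pcarrier \<alpha> = (\<Union>t. pmap \<alpha> t ` S)" "\<And>x. x \<in> S \<Longrightarrow> \<phi> x = \<psi> x"
    and "z \<in> pcarrier \<alpha>"
  shows "\<phi> z = \<psi> z"
proof -
  obtain t x where "x \<in> S" "z = pmap \<alpha> t x"
    using assms by blast
  moreover from this have "x \<in> pdom \<alpha> (- t)"
    using assms(4) global_action_dom[OF assms(1)] by blast
  ultimately show ?thesis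
    using assms(6) by (simp add: morphism_equivariant[OF assms(2)] morphism_equivariant[OF assms(3)])
qed

section \<open>The enveloping action\<close>

text \<open>The equivalence class of (r, x) as a concrete set of pairs, so that the quotient lives
  on the type of sets over \<open>G \<times> X\<close>. In additive notation r g^{-1} becomes
  \<open>r - g\<close>.\<close>

definition pclass :: "('g::topological_group_add, 'x) paction \<Rightarrow> 'g \<times> 'x \<Rightarrow> ('g \<times> 'x) set" where
  "pclass \<alpha> = (\<lambda>(r, x). {(r - g, pmap \<alpha> g x) | g. x \<in> pdom \<alpha> (- g)})"

text \<open>Translating a class elementwise involves no representative, so the action is well
  defined by construction; \<open>pmap_envelope\<close> confirms that it maps classes to
  classes.\<close>

definition envelope :: "('g::topological_group_add, 'x) paction \<Rightarrow> ('g, ('g \<times> 'x) set) paction" where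
  "envelope \<alpha> =
     \<lparr>pspace = quotient_topology (prod_topology euclidean (pspace \<alpha>)) (pclass \<alpha>),
      pdom = (\<lambda>t. pclass \<alpha> ` (UNIV \<times> pcarrier \<alpha>)),
      pmap = (\<lambda>t C. (\<lambda>(s, y). (t + s, y)) ` C)\<rparr>"

lemma pspace_envelope:
  "pspace (envelope \<alpha>) = quotient_topology (prod_topology euclidean (pspace \<alpha>)) (pclass \<alpha>)"
  by (simp add: envelope_def)

lemma pcarrier_envelope: "pcarrier (envelope \<alpha>) = pclass \<alpha> ` (UNIV \<times> pcarrier \<alpha>)"
  by (simp add: pspace_envelope)

lemma pdom_envelope: "pdom (envelope \<alpha>) t = pcarrier (envelope \<alpha>)"
  unfolding pcarrier_envelope by (simp add: envelope_def)

lemma pmap_envelope: "pmap (envelope \<alpha>) t (pclass \<alpha> (r, x)) = pclass \<alpha> (t + r, x)"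
  by (simp add: envelope_def pclass_def setcompr_eq_image image_image add_diff_eq)

text \<open>Shifting by \<open>g\<close> and then by \<open>h\<close> is shifting by
  \<open>h + g\<close>, which gives the inclusion \<open>sub\<close>. The reverse inclusion is
  \<open>sub\<close> for the shifted pair and \<open>- g\<close>, since that shift leads back to
  \<open>(r, x)\<close>.\<close>

lemma pclass_shift:
  assumes "partial_action \<alpha>" "x \<in> pdom \<alpha> (- g)"
  shows "pclass \<alpha> (r - g, pmap \<alpha> g x) = pclass \<alpha> (r, x)"
proof
  have sub: "pclass \<alpha> (r - g, pmap \<alpha> g x) \<subseteq> pclass \<alpha> (r, x)" if "x \<in> pdom \<alpha> (- g)" for r g x
  proof
    fix p assume "p \<in> pclass \<alpha> (r - g, pmap \<alpha> g x)"
    then obtain h where h: "pmap \<alpha> g x \<in> pdom \<alpha> (- h)" "p = (r - g - h, pmap \<alpha> h (pmap \<alpha> g x))"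
      by (auto simp: pclass_def)
    \<comment> \<open>The order matters because \<open>G\<close> need not commute: -(h + g) = -g -
      h.\<close>
    moreover have "r - (h + g) = r - g - h"
      by (simp add: diff_diff_eq2 algebra_simps)
    ultimately have "p = (r - (h + g), pmap \<alpha> (h + g) x)" "x \<in> pdom \<alpha> (- (h + g))"
      using partial_action_add[OF assms(1) that h(1)] by simp_all
    then show "p \<in> pclass \<alpha> (r, x)"
      unfolding pclass_def by blast
  qed
  then show "pclass \<alpha> (r - g, pmap \<alpha> g x) \<subseteq> pclass \<alpha> (r, x)"
    using assms by blast
  show "pclass \<alpha> (r, x) \<subseteq> pclass \<alpha> (r - g, pmap \<alpha> g x)"
    using sub[of "pmap \<alpha> g x" "- g" "r - g"] assms
    by (simp add: partial_action_mem partial_action_inverse)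
qed

lemma pclass_self:
  assumes "partial_action \<alpha>" "x \<in> pcarrier \<alpha>"
  shows "(r, x) \<in> pclass \<alpha> (r, x)"
proof -
  have "(r, x) = (r - 0, pmap \<alpha> 0 x) \<and> x \<in> pdom \<alpha> (- 0)"
    using assms by (simp add: partial_action_zero partial_action_dom_zero)
  then show ?thesis
    unfolding pclass_def by blast
qed

text \<open>The point \<open>y\<close> has to lie in the carrier for \<open>(s, y)\<close> to belong
  to its own class; outside the carrier all classes are empty and therefore equal.\<close>

lemma pclass_eq_iff:
  assumes "partial_action \<alpha>" "y \<in> pcarrier \<alpha>"
  shows "pclass \<alpha> (r, x) = pclass \<alpha> (s, y) \<longleftrightarrow> (\<exists>g. x \<in> pdom \<alpha> (- g) \<and> s = r - g \<and> y = pmap \<alpha> g x)"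
proof
  assume "pclass \<alpha> (r, x) = pclass \<alpha> (s, y)"
  then have "(s, y) \<in> pclass \<alpha> (r, x)"
    using pclass_self[OF assms] by simp
  then show "\<exists>g. x \<in> pdom \<alpha> (- g) \<and> s = r - g \<and> y = pmap \<alpha> g x"
    by (auto simp: pclass_def)
qed (auto simp: pclass_shift[OF assms(1)])

text \<open>This computes the saturation of \<open>U\<close>, the set whose openness decides whether
  the image of \<open>U\<close> is open in the quotient.\<close>

lemma pclass_in_image_iff:
  assumes "partial_action \<alpha>" "U \<subseteq> UNIV \<times> pcarrier \<alpha>"
  shows "pclass \<alpha> (s, y) \<in> pclass \<alpha> ` U \<longleftrightarrow> (\<exists>g. y \<in> pdom \<alpha> (- g) \<and> (s - g, pmap \<alpha> g y) \<in> U)"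
proof
  assume "pclass \<alpha> (s, y) \<in> pclass \<alpha> ` U"
  then obtain r x where rx: "(r, x) \<in> U" "pclass \<alpha> (s, y) = pclass \<alpha> (r, x)"
    by auto
  then have "x \<in> pcarrier \<alpha>"
    using assms by blast
  with rx show "\<exists>g. y \<in> pdom \<alpha> (- g) \<and> (s - g, pmap \<alpha> g y) \<in> U"
    unfolding pclass_eq_iff[OF assms(1) \<open>x \<in> pcarrier \<alpha>\<close>] by blast
next
  assume "\<exists>g. y \<in> pdom \<alpha> (- g) \<and> (s - g, pmap \<alpha> g y) \<in> U"
  then show "pclass \<alpha> (s, y) \<in> pclass \<alpha> ` U"
    by (auto simp: pclass_shift[OF assms(1)] dest: imageI[where f = "pclass \<alpha>"])
qed

section \<open>Openness of the quotient map and joint continuity of the action\<close>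

lemma quotient_map_pclass:
  "quotient_map (prod_topology euclidean (pspace \<alpha>)) (pspace (envelope \<alpha>)) (pclass \<alpha>)"
  unfolding pspace_envelope by (rule quotient_map_quotient_topology)

lemma open_map_pclass:
  fixes \<alpha> :: "('g::topological_group_add, 'x) paction"
  assumes "partial_action \<alpha>"
  shows "open_map (prod_topology euclidean (pspace \<alpha>)) (pspace (envelope \<alpha>)) (pclass \<alpha>)"
  unfolding open_map_def
proof (intro allI impI)
  fix U :: "('g \<times> 'x) set" assume U: "openin (prod_topology euclidean (pspace \<alpha>)) U"
  let ?X = "prod_topology (euclidean :: 'g topology) (pspace \<alpha>)"
  \<comment> \<open>The part of the saturation of \<open>U\<close> contributed by \<open>g\<close>:
    the preimage of \<open>U\<close> under the partial homeomorphism (s, y) -> (s - g,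
    \<alpha>_g(y)).\<close>
  let ?V = "\<lambda>g. {p \<in> UNIV \<times> pdom \<alpha> (- g). (case p of (s, y) \<Rightarrow> (s - g, pmap \<alpha> g y)) \<in> U}"
  have sub: "U \<subseteq> UNIV \<times> pcarrier \<alpha>"
    using openin_subset[OF U] by simp
  have "openin ?X (?V g)" for g
  proof -
    let ?D = "subtopology (pspace \<alpha>) (pdom \<alpha> (- g))"
    have dom: "openin (pspace \<alpha>) (pdom \<alpha> (- g))"
      using assms by (simp add: partial_action_def)
    have "continuous_map ?D (subtopology (pspace \<alpha>) (pdom \<alpha> g)) (pmap \<alpha> g)"
      using assms by (simp add: partial_action_def homeomorphic_imp_continuous_map)
    then have "continuous_map ?D (pspace \<alpha>) (pmap \<alpha> g)"
      by (rule continuous_map_into_fulltopology)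
    moreover have "continuous_map euclidean euclidean (\<lambda>s::'g. s + (- g))"
      by (intro continuous_map_plus) auto
    ultimately have "continuous_map (prod_topology euclidean ?D) ?X (\<lambda>(s, y). (s - g, pmap \<alpha> g y))"
      by (simp add: continuous_map_prod_top)
    from openin_continuous_map_preimage[OF this U]
    have "openin (prod_topology euclidean ?D) (?V g)"
      using openin_subset[OF dom] by (simp add: inf.absorb2)
    moreover have "prod_topology euclidean ?D = subtopology ?X (UNIV \<times> pdom \<alpha> (- g))"
      by (simp add: prod_topology_subtopology)
    moreover have "openin ?X (UNIV \<times> pdom \<alpha> (- g))"
      using dom by (simp add: openin_prod_Times_iff)
    ultimately show ?thesis
      using openin_trans_full[of ?X "UNIV \<times> pdom \<alpha> (- g)"] by simp
  qed
  then have "openin ?X (\<Union>g. ?V g)"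
    by blast
  moreover have "{p \<in> topspace ?X. pclass \<alpha> p \<in> pclass \<alpha> ` U} = (\<Union>g. ?V g)"
  proof (rule set_eqI)
    fix p :: "'g \<times> 'x"
    obtain s y where "p = (s, y)" by (cases p)
    then show "p \<in> {p \<in> topspace ?X. pclass \<alpha> p \<in> pclass \<alpha> ` U} \<longleftrightarrow> p \<in> (\<Union>g. ?V g)"
      using partial_action_dom_subset[OF assms]
      by (simp add: pclass_in_image_iff[OF assms sub]) blast
  qed
  ultimately have "openin ?X {p \<in> topspace ?X. pclass \<alpha> p \<in> pclass \<alpha> ` U}"
    by simp
  then show "openin (pspace (envelope \<alpha>)) (pclass \<alpha> ` U)"
    using sub by (auto simp: pspace_envelope openin_quotient_topology)
qed

lemma global_action_envelope:
  fixes \<alpha> :: "('g::topological_group_add, 'x) paction"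
  assumes "partial_action \<alpha>"
  shows "global_action (envelope \<alpha>)"
  unfolding global_action_iff
proof (intro conjI allI ballI)
  let ?G = "euclidean :: 'g topology"
  let ?X = "prod_topology ?G (pspace \<alpha>)"
  let ?E = "pspace (envelope \<alpha>)"
  let ?q = "\<lambda>(t :: 'g, p). (t, pclass \<alpha> p)"
  \<comment> \<open>Continuity on \<open>G \<times> X^e\<close> can be tested after composition with
    \<open>?q\<close>, once \<open>?q\<close> is known to be a quotient map. It is one because it is
    continuous, open and surjective.\<close>
  have q: "quotient_map (prod_topology ?G ?X) (prod_topology ?G ?E) ?q"
  proof (rule continuous_open_imp_quotient_map)
    show "continuous_map (prod_topology ?G ?X) (prod_topology ?G ?E) ?q"
      using quotient_imp_continuous_map[OF quotient_map_pclass[of \<alpha>]]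
      by (simp add: continuous_map_prod_top)
    show "open_map (prod_topology ?G ?X) (prod_topology ?G ?E) ?q"
      using open_map_prod_top[OF open_map_id open_map_pclass[OF assms]] by simp
    show "?q ` topspace (prod_topology ?G ?X) = topspace (prod_topology ?G ?E)"
      by (force simp: pcarrier_envelope)
  qed
  have "continuous_map (prod_topology ?G ?X) ?G (\<lambda>p. fst p + fst (snd p))"
    by (intro continuous_map_plus continuous_map_fst
        continuous_map_compose[OF continuous_map_snd continuous_map_fst, unfolded o_def])
  then have "continuous_map (prod_topology ?G ?X) ?X (\<lambda>p. (fst p + fst (snd p), snd (snd p)))"
    by (intro continuous_map_pairedI
        continuous_map_compose[OF continuous_map_snd continuous_map_snd, unfolded o_def])
  then have "continuous_map (prod_topology ?G ?X) ?E
      (pclass \<alpha> \<circ> (\<lambda>p. (fst p + fst (snd p), snd (snd p))))"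
    using quotient_imp_continuous_map[OF quotient_map_pclass] continuous_map_compose by blast
  \<comment> \<open>Both sides send (t, (r, x)) to the class of (t + r, x): the action lifts to left
    translation on \<open>G \<times> X\<close>, whose continuity was just shown.\<close>
  moreover have "pclass \<alpha> \<circ> (\<lambda>p. (fst p + fst (snd p), snd (snd p))) =
      (\<lambda>(t, C). pmap (envelope \<alpha>) t C) \<circ> ?q"
    by (auto simp: fun_eq_iff pmap_envelope)
  ultimately show "continuous_map (prod_topology ?G ?E) ?E (\<lambda>(t, C). pmap (envelope \<alpha>) t C)"
    by (intro continuous_compose_quotient_map[OF q]) simp
qed (auto simp: pdom_envelope pcarrier_envelope pmap_envelope add.assoc)

section \<open>The canonical open embedding of X into the envelope\<close>

definition unit_map :: "('g::topological_group_add, 'x) paction \<Rightarrow> 'x \<Rightarrow> ('g \<times> 'x) set" where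
  "unit_map \<alpha> x = pclass \<alpha> (0, x)"

lemma morphism_unit_map:
  fixes \<alpha> :: "('g::topological_group_add, 'x) paction"
  assumes "partial_action \<alpha>"
  shows "morphism \<alpha> (envelope \<alpha>) (unit_map \<alpha>)"
  unfolding morphism_def
proof (intro conjI allI ballI)
  have "continuous_map (pspace \<alpha>) (prod_topology euclidean (pspace \<alpha>)) (\<lambda>x. (0 :: 'g, x))"
    by (simp add: continuous_map_pairedI)
  from continuous_map_compose[OF this quotient_imp_continuous_map[OF quotient_map_pclass]]
  show "continuous_map (pspace \<alpha>) (pspace (envelope \<alpha>)) (unit_map \<alpha>)"
    by (simp add: o_def unit_map_def[abs_def])
  show "unit_map \<alpha> ` pdom \<alpha> t \<subseteq> pdom (envelope \<alpha>) t" for t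
    unfolding pdom_envelope pcarrier_envelope unit_map_def
    using partial_action_dom_subset[OF assms, of t] by blast
  show "unit_map \<alpha> (pmap \<alpha> t x) = pmap (envelope \<alpha>) t (unit_map \<alpha> x)" if "x \<in> pdom \<alpha> (- t)" for t x
    using pclass_shift[OF assms that, of t] unfolding unit_map_def pmap_envelope by simp
qed

text \<open>The class of (t, x) is the translate by \<open>t\<close> of the class of (0, x).\<close>

lemma orbit_unit_map:
  "pcarrier (envelope \<alpha>) = (\<Union>t. pmap (envelope \<alpha>) t ` (unit_map \<alpha> ` pcarrier \<alpha>))"
proof -
  have "(\<Union>t. pmap (envelope \<alpha>) t ` (unit_map \<alpha> ` pcarrier \<alpha>)) = (\<Union>t. (\<lambda>x. pclass \<alpha> (t, x)) ` pcarrier \<alpha>)"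
    by (simp add: image_image unit_map_def pmap_envelope)
  then show ?thesis
    unfolding pcarrier_envelope by auto
qed

lemma open_map_unit_map:
  fixes \<alpha> :: "('g::topological_group_add, 'x) paction"
  assumes "partial_action \<alpha>"
  shows "open_map (pspace \<alpha>) (pspace (envelope \<alpha>)) (unit_map \<alpha>)"
  unfolding open_map_def
proof (intro allI impI)
  fix U assume U: "openin (pspace \<alpha>) U"
  let ?X = "prod_topology (euclidean :: 'g topology) (pspace \<alpha>)"
  have sub: "U \<subseteq> pcarrier \<alpha>"
    by (rule openin_subset[OF U])
  have graph: "openin ?X (pgraph \<alpha>)"
    using assms by (simp add: partial_action_def)
  have "continuous_map (subtopology ?X (pgraph \<alpha>)) (pspace \<alpha>) (\<lambda>(t, x). pmap \<alpha> t x)"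
    using assms by (simp add: partial_action_def)
  from openin_continuous_map_preimage[OF this U]
  have "openin (subtopology ?X (pgraph \<alpha>)) {p \<in> pgraph \<alpha>. (\<lambda>(t, x). pmap \<alpha> t x) p \<in> U}"
    by (simp only: topspace_subtopology_subset[OF openin_subset[OF graph]])
  then have "openin ?X {p \<in> pgraph \<alpha>. (\<lambda>(t, x). pmap \<alpha> t x) p \<in> U}"
    using graph openin_trans_full by blast
  moreover have "{p \<in> topspace ?X. pclass \<alpha> p \<in> unit_map \<alpha> ` U} =
      {p \<in> pgraph \<alpha>. (\<lambda>(t, x). pmap \<alpha> t x) p \<in> U}"
  proof -
    have "unit_map \<alpha> ` U = pclass \<alpha> ` ({0} \<times> U)"
      by (auto simp: unit_map_def)
    \<comment> \<open>The first coordinate must satisfy s - g = 0, so only \<open>g = s\<close>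
      contributes and the union over \<open>g\<close> in the saturation collapses to one condition
      on the graph.\<close>
    moreover have "pclass \<alpha> (s, y) \<in> pclass \<alpha> ` ({0} \<times> U) \<longleftrightarrow> y \<in> pdom \<alpha> (- s) \<and> pmap \<alpha> s y \<in> U" for s y
    proof -
      have "(s - g, pmap \<alpha> g y) \<in> {0} \<times> U \<longleftrightarrow> g = s \<and> pmap \<alpha> s y \<in> U" for g
        by auto
      then show ?thesis
        using pclass_in_image_iff[OF assms, of "{0} \<times> U" s y] sub by auto
    qed
    ultimately have "pclass \<alpha> (s, y) \<in> unit_map \<alpha> ` U \<longleftrightarrow> y \<in> pdom \<alpha> (- s) \<and> pmap \<alpha> s y \<in> U" for s y
      by simp
    then have "p \<in> topspace ?X \<and> pclass \<alpha> p \<in> unit_map \<alpha> ` U \<longleftrightarrow>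
        p \<in> pgraph \<alpha> \<and> (\<lambda>(t, x). pmap \<alpha> t x) p \<in> U" for p
      using partial_action_dom_subset[OF assms]
      by (cases p) (simp add: pgraph_def, blast)
    then show ?thesis
      by simp
  qed
  ultimately show "openin (pspace (envelope \<alpha>)) (unit_map \<alpha> ` U)"
    using sub by (auto simp: pspace_envelope openin_quotient_topology unit_map_def)
qed

lemma inj_on_unit_map:
  assumes "partial_action \<alpha>"
  shows "inj_on (unit_map \<alpha>) (pcarrier \<alpha>)"
proof (rule inj_onI)
  fix x y assume xy: "x \<in> pcarrier \<alpha>" "y \<in> pcarrier \<alpha>" "unit_map \<alpha> x = unit_map \<alpha> y"
  \<comment> \<open>Equal first coordinates force \<open>g = 0\<close>, and \<alpha>_0 is the
    identity.\<close>
  from xy(3) have "\<exists>g. x \<in> pdom \<alpha> (- g) \<and> 0 = 0 - g \<and> y = pmap \<alpha> g x"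
    unfolding unit_map_def pclass_eq_iff[OF assms xy(2)] .
  then show "x = y"
    using partial_action_zero[OF assms xy(1)] by auto
qed

section \<open>Universal property of the envelope\<close>

lemma envelope_extension:
  fixes \<alpha> :: "('g::topological_group_add, 'x) paction" and \<beta> :: "('g, 'y) paction"
  assumes \<alpha>: "partial_action \<alpha>" and \<beta>: "global_action \<beta>" and \<psi>: "morphism \<alpha> \<beta> \<psi>"
  obtains \<psi>e where "morphism (envelope \<alpha>) \<beta> \<psi>e" "\<And>x. x \<in> pcarrier \<alpha> \<Longrightarrow> \<psi>e (unit_map \<alpha> x) = \<psi> x"
proof -
  let ?X = "prod_topology (euclidean :: 'g topology) (pspace \<alpha>)"
  \<comment> \<open>Equivariance forces this formula: the class of (r, x) is the translate by
    \<open>r\<close> of the image of \<open>x\<close>, so it has to go to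
    \<beta>_r(\<psi>(x)).\<close>
  let ?h = "\<lambda>(r, x). pmap \<beta> r (\<psi> x)"
  have add: "pmap \<beta> (s + t) y = pmap \<beta> s (pmap \<beta> t y)" if "y \<in> pcarrier \<beta>" for s t y
    using \<beta> that unfolding global_action_iff by blast
  have "continuous_map ?X (prod_topology euclidean (pspace \<beta>)) (\<lambda>(r, x). (r, \<psi> x))"
    using \<psi> by (simp add: continuous_map_prod_top morphism_def)
  moreover have "continuous_map (prod_topology euclidean (pspace \<beta>)) (pspace \<beta>) (\<lambda>(t, x). pmap \<beta> t x)"
    using \<beta> by (simp add: global_action_iff)
  ultimately have "continuous_map ?X (pspace \<beta>) ((\<lambda>(t, x). pmap \<beta> t x) \<circ> (\<lambda>(r, x). (r, \<psi> x)))"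
    by (rule continuous_map_compose)
  then have cont: "continuous_map ?X (pspace \<beta>) ?h"
    by (simp add: o_def case_prod_unfold)
  \<comment> \<open>The formula is constant on classes because \<beta>_{r-g} \<beta>_g = \<beta>_r,
    and hence it descends to a continuous map on the quotient.\<close>
  have compat: "?h p = ?h p'" if "p \<in> topspace ?X" "p' \<in> topspace ?X" "pclass \<alpha> p = pclass \<alpha> p'" for p p'
  proof -
    obtain r x s y where p: "p = (r, x)" "p' = (s, y)"
      by (metis surj_pair)
    with that have xy: "x \<in> pcarrier \<alpha>" "y \<in> pcarrier \<alpha>" "pclass \<alpha> (r, x) = pclass \<alpha> (s, y)"
      by simp_all
    from xy(3) obtain g where g: "x \<in> pdom \<alpha> (- g)" "s = r - g" "y = pmap \<alpha> g x"
      unfolding pclass_eq_iff[OF \<alpha> xy(2)] by blast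
    have "pmap \<beta> s (\<psi> y) = pmap \<beta> (r - g) (pmap \<beta> g (\<psi> x))"
      using g morphism_equivariant[OF \<psi>] by simp
    also have "\<dots> = pmap \<beta> r (\<psi> x)"
      using add[of "\<psi> x" "r - g" g] morphism_mem[OF \<psi> xy(1)] by simp
    finally show ?thesis
      by (simp add: p)
  qed
  obtain f where f: "continuous_map (pspace (envelope \<alpha>)) (pspace \<beta>) f"
      "\<And>p. p \<in> topspace ?X \<Longrightarrow> f (pclass \<alpha> p) = ?h p"
    by (rule quotient_map_lift_exists[OF quotient_map_pclass cont compat]) blast+
  show thesis
  proof
    show "f (unit_map \<alpha> x) = \<psi> x" if "x \<in> pcarrier \<alpha>" for x
      using f(2)[of "(0, x)"] that \<beta> morphism_mem[OF \<psi> that]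
      by (simp add: unit_map_def global_action_iff)
    show "morphism (envelope \<alpha>) \<beta> f"
      unfolding morphism_def
    proof (intro conjI allI ballI)
      show "f ` pdom (envelope \<alpha>) t \<subseteq> pdom \<beta> t" for t
        using continuous_map_image_subset_topspace[OF f(1)]
        by (simp add: global_action_dom[OF \<beta>] pdom_envelope)
      fix t C assume "C \<in> pdom (envelope \<alpha>) (- t)"
      then obtain r x where C: "x \<in> pcarrier \<alpha>" "C = pclass \<alpha> (r, x)"
        by (auto simp: pdom_envelope pcarrier_envelope)
      then show "f (pmap (envelope \<alpha>) t C) = pmap \<beta> t (f C)"
        using f(2)[of "(t + r, x)"] f(2)[of "(r, x)"] add morphism_mem[OF \<psi>]
        by (simp add: pmap_envelope)
    qed (rule f(1))
  qed
qed

lemma universal_pair_envelope: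
  fixes \<alpha> :: "('g::topological_group_add, 'x) paction"
  assumes "partial_action \<alpha>"
  shows "universal_pair TYPE('y) \<alpha> (unit_map \<alpha>) (envelope \<alpha>)"
  unfolding universal_pair_def
proof (intro conjI allI impI)
  fix \<beta> :: "('g, 'y) paction" and \<psi>
  assume "global_action \<beta> \<and> morphism \<alpha> \<beta> \<psi>"
  then have \<beta>: "global_action \<beta>" and \<psi>: "morphism \<alpha> \<beta> \<psi>"
    by blast+
  obtain f where f: "morphism (envelope \<alpha>) \<beta> f" "\<And>x. x \<in> pcarrier \<alpha> \<Longrightarrow> f (unit_map \<alpha> x) = \<psi> x"
    using envelope_extension[OF assms \<beta> \<psi>] by blast
  have "\<eta> z = f z"
    if "morphism (envelope \<alpha>) \<beta> \<eta>" "\<forall>x \<in> pcarrier \<alpha>. \<eta> (unit_map \<alpha> x) = \<psi> x"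
      "z \<in> pcarrier (envelope \<alpha>)" for \<eta> z
  proof (rule morphism_agree_on_orbit[OF global_action_envelope[OF assms] that(1) f(1)
        _ orbit_unit_map _ that(3)])
    show "unit_map \<alpha> ` pcarrier \<alpha> \<subseteq> pcarrier (envelope \<alpha>)"
      using morphism_mem[OF morphism_unit_map[OF assms]] by blast
  qed (use f(2) that(2) in auto)
  with f show "\<exists>\<psi>e. morphism (envelope \<alpha>) \<beta> \<psi>e \<and> (\<forall>x \<in> pcarrier \<alpha>. \<psi>e (unit_map \<alpha> x) = \<psi> x) \<and>
      (\<forall>\<eta>. morphism (envelope \<alpha>) \<beta> \<eta> \<and> (\<forall>x \<in> pcarrier \<alpha>. \<eta> (unit_map \<alpha> x) = \<psi> x) \<longrightarrow>
        (\<forall>z \<in> pcarrier (envelope \<alpha>). \<eta> z = \<psi>e z))"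
    by blast
qed (use assms global_action_envelope morphism_unit_map in auto)

section \<open>Consequences of the universal property\<close>

lemma universal_pairD:
  assumes "universal_pair TYPE('y) \<alpha> \<iota> \<alpha>e"
  shows "global_action \<alpha>e" "morphism \<alpha> \<alpha>e \<iota>"
  using assms by (simp_all add: universal_pair_def)

lemma universal_pair_extension:
  fixes \<beta> :: "('g::topological_group_add, 'y) paction"
  assumes "universal_pair TYPE('y) \<alpha> \<iota> \<alpha>e" "global_action \<beta>" "morphism \<alpha> \<beta> \<psi>"
  obtains \<psi>e where "morphism \<alpha>e \<beta> \<psi>e" "\<And>x. x \<in> pcarrier \<alpha> \<Longrightarrow> \<psi>e (\<iota> x) = \<psi> x"
  using assms unfolding universal_pair_def by metis

text \<open>Both morphisms extend the same morphism, \<open>\<eta>\<close> after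
  \<open>\<iota>\<close>, so both agree with its unique extension.\<close>

lemma universal_pair_unique:
  fixes \<beta> :: "('g::topological_group_add, 'y) paction"
  assumes "universal_pair TYPE('y) \<alpha> \<iota> \<alpha>e" "global_action \<beta>"
    and "morphism \<alpha>e \<beta> \<eta>" "morphism \<alpha>e \<beta> \<eta>'" "\<And>x. x \<in> pcarrier \<alpha> \<Longrightarrow> \<eta> (\<iota> x) = \<eta>' (\<iota> x)"
    and "z \<in> pcarrier \<alpha>e"
  shows "\<eta> z = \<eta>' z"
proof -
  have "morphism \<alpha> \<beta> (\<lambda>x. \<eta> (\<iota> x))"
    by (rule morphism_compose[OF universal_pairD(2)[OF assms(1)] assms(3)])
  then have "\<exists>f. \<forall>\<theta>. morphism \<alpha>e \<beta> \<theta> \<and> (\<forall>x \<in> pcarrier \<alpha>. \<theta> (\<iota> x) = \<eta> (\<iota> x)) \<longrightarrow>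
      (\<forall>z \<in> pcarrier \<alpha>e. \<theta> z = f z)"
    using assms(1,2) unfolding universal_pair_def by blast
  then obtain f where f: "\<And>\<theta>. morphism \<alpha>e \<beta> \<theta> \<Longrightarrow> (\<forall>x \<in> pcarrier \<alpha>. \<theta> (\<iota> x) = \<eta> (\<iota> x)) \<Longrightarrow>
      (\<forall>z \<in> pcarrier \<alpha>e. \<theta> z = f z)"
    by blast
  have "\<eta> z = f z"
    using f[OF assms(3)] assms(6) by blast
  also have "\<dots> = \<eta>' z"
    using f[OF assms(4)] assms(5,6) by simp
  finally show ?thesis .
qed

text \<open>The usual argument for universal objects, with types tracked: \<open>f\<close> gives
  \<open>\<phi>\<close>, \<open>e'\<close> gives \<open>\<psi>\<close>, and uniqueness from
  \<open>e\<close> and \<open>f'\<close> makes the two composites identities.\<close>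

lemma universal_pair_isomorphism:
  fixes \<alpha>e :: "('g::topological_group_add, 'e) paction" and \<alpha>e' :: "('g, 'f) paction"
  assumes e: "universal_pair TYPE('e) \<alpha> \<iota> \<alpha>e" and f: "universal_pair TYPE('f) \<alpha> \<iota> \<alpha>e"
    and e': "universal_pair TYPE('e) \<alpha> \<iota>' \<alpha>e'" and f': "universal_pair TYPE('f) \<alpha> \<iota>' \<alpha>e'"
  obtains \<phi> where "isomorphism \<alpha>e \<alpha>e' \<phi>" "\<And>x. x \<in> pcarrier \<alpha> \<Longrightarrow> \<phi> (\<iota> x) = \<iota>' x"
proof -
  obtain \<phi> where \<phi>: "morphism \<alpha>e \<alpha>e' \<phi>" "\<And>x. x \<in> pcarrier \<alpha> \<Longrightarrow> \<phi> (\<iota> x) = \<iota>' x"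
    using universal_pair_extension[OF f universal_pairD[OF e']] by blast
  obtain \<psi> where \<psi>: "morphism \<alpha>e' \<alpha>e \<psi>" "\<And>x. x \<in> pcarrier \<alpha> \<Longrightarrow> \<psi> (\<iota>' x) = \<iota> x"
    using universal_pair_extension[OF e' universal_pairD[OF e]] by blast
  have "\<psi> (\<phi> z) = z" if "z \<in> pcarrier \<alpha>e" for z
    by (rule universal_pair_unique[OF e universal_pairD(1)[OF e]
          morphism_compose[OF \<phi>(1) \<psi>(1)] morphism_ident _ that])
      (simp add: \<phi>(2) \<psi>(2))
  moreover have "\<phi> (\<psi> z) = z" if "z \<in> pcarrier \<alpha>e'" for z
    by (rule universal_pair_unique[OF f' universal_pairD(1)[OF e']
          morphism_compose[OF \<psi>(1) \<phi>(1)] morphism_ident _ that])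
      (simp add: \<phi>(2) \<psi>(2))
  ultimately have "isomorphism \<alpha>e \<alpha>e' \<phi>"
    using \<phi>(1) \<psi>(1) unfolding isomorphism_def by blast
  with \<phi>(2) show thesis
    using that by blast
qed

text \<open>Extensions are precomposed with the inverse isomorphism; uniqueness is pulled back along
  \<open>\<phi>\<close>. The isomorphism thus carries universality at a type \<open>'y\<close> from
  one pair to another.\<close>

lemma universal_pair_transfer:
  fixes \<alpha> :: "('g::topological_group_add, 'x) paction"
  assumes u: "universal_pair TYPE('y) \<alpha> \<iota> \<alpha>e" and iso: "isomorphism \<alpha>e \<alpha>e' \<phi>"
    and \<iota>': "\<And>x. x \<in> pcarrier \<alpha> \<Longrightarrow> \<phi> (\<iota> x) = \<iota>' x"
    and g: "global_action \<alpha>e'" and m: "morphism \<alpha> \<alpha>e' \<iota>'"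
  shows "universal_pair TYPE('y) \<alpha> \<iota>' \<alpha>e'"
  unfolding universal_pair_def
proof (intro conjI allI impI)
  obtain \<psi> where \<phi>: "morphism \<alpha>e \<alpha>e' \<phi>" and \<psi>: "morphism \<alpha>e' \<alpha>e \<psi>"
    and inv: "\<And>z. z \<in> pcarrier \<alpha>e \<Longrightarrow> \<psi> (\<phi> z) = z" "\<And>z. z \<in> pcarrier \<alpha>e' \<Longrightarrow> \<phi> (\<psi> z) = z"
    using iso unfolding isomorphism_def by blast
  fix \<beta> :: "('g, 'y) paction" and \<theta>
  assume "global_action \<beta> \<and> morphism \<alpha> \<beta> \<theta>"
  then have \<beta>: "global_action \<beta>" and \<theta>: "morphism \<alpha> \<beta> \<theta>"
    by blast+
  obtain h where h: "morphism \<alpha>e \<beta> h" "\<And>x. x \<in> pcarrier \<alpha> \<Longrightarrow> h (\<iota> x) = \<theta> x"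
    using universal_pair_extension[OF u \<beta> \<theta>] by blast
  show "\<exists>\<theta>e. morphism \<alpha>e' \<beta> \<theta>e \<and> (\<forall>x \<in> pcarrier \<alpha>. \<theta>e (\<iota>' x) = \<theta> x) \<and>
      (\<forall>\<eta>. morphism \<alpha>e' \<beta> \<eta> \<and> (\<forall>x \<in> pcarrier \<alpha>. \<eta> (\<iota>' x) = \<theta> x) \<longrightarrow>
        (\<forall>z \<in> pcarrier \<alpha>e'. \<eta> z = \<theta>e z))"
  proof (rule exI[of _ "\<lambda>z. h (\<psi> z)"], intro conjI allI impI ballI, goal_cases)
    case 1
    show ?case by (rule morphism_compose[OF \<psi> h(1)])
  next
    case (2 x)
    then have "\<iota> x \<in> pcarrier \<alpha>e"
      by (rule morphism_mem[OF universal_pairD(2)[OF u]])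
    then show ?case
      by (simp add: inv(1) \<iota>'[OF 2, symmetric] h(2)[OF 2])
  next
    case (3 \<eta> z)
    \<comment> \<open>Both \<open>h\<close> and \<open>\<eta>\<close> after \<open>\<phi>\<close>
      extend \<open>\<theta>\<close> along \<open>\<iota>\<close>, so they coincide; evaluating at
      \<open>\<psi> z\<close> gives the claim.\<close>
    have "\<eta> (\<phi> w) = h w" if "w \<in> pcarrier \<alpha>e" for w
    proof (rule universal_pair_unique[OF u \<beta> morphism_compose[OF \<phi>] h(1) _ that])
      show "morphism \<alpha>e' \<beta> \<eta>" using 3 by blast
      show "\<eta> (\<phi> (\<iota> x)) = h (\<iota> x)" if "x \<in> pcarrier \<alpha>" for x
        using 3 that \<iota>' h(2) by simp
    qed
    from this[of "\<psi> z"] show ?case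
      using morphism_mem[OF \<psi> 3(2)] inv(2)[OF 3(2)] by simp
  qed
qed (use g m in auto)

lemma isomorphism_imp_homeomorphic_map:
  assumes "isomorphism \<alpha> \<beta> \<phi>"
  shows "homeomorphic_map (pspace \<alpha>) (pspace \<beta>) \<phi>"
proof -
  obtain \<psi> where "morphism \<alpha> \<beta> \<phi>" "morphism \<beta> \<alpha> \<psi>"
    "\<forall>x \<in> pcarrier \<alpha>. \<psi> (\<phi> x) = x" "\<forall>y \<in> pcarrier \<beta>. \<phi> (\<psi> y) = y"
    using assms unfolding isomorphism_def by blast
  then have "homeomorphic_maps (pspace \<alpha>) (pspace \<beta>) \<phi> \<psi>"
    by (simp add: morphism_def homeomorphic_maps_def)
  then show ?thesis
    using homeomorphic_map_maps by blast
qed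

text \<open>Two test types suffice: universality against the type of the envelope and against the
  pair's own type yields an isomorphism with the envelope. As the envelope is universal at every
  type, all its properties pass along that isomorphism.\<close>

lemma universal_pair_open_embedding:
  fixes \<alpha> :: "('g::topological_group_add, 'x) paction" and \<alpha>e :: "('g, 'e) paction"
  assumes \<alpha>: "partial_action \<alpha>"
    and u: "universal_pair TYPE(('g \<times> 'x) set) \<alpha> \<iota> \<alpha>e" and e: "universal_pair TYPE('e) \<alpha> \<iota> \<alpha>e"
  shows "universal_pair TYPE('y) \<alpha> \<iota> \<alpha>e"
    and "openin (pspace \<alpha>e) (\<iota> ` pcarrier \<alpha>)"
    and "homeomorphic_map (pspace \<alpha>) (subtopology (pspace \<alpha>e) (\<iota> ` pcarrier \<alpha>)) \<iota>"
    and "pcarrier \<alpha>e = (\<Union>t. pmap \<alpha>e t ` (\<iota> ` pcarrier \<alpha>))"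
proof -
  let ?E = "envelope \<alpha>" and ?j = "unit_map \<alpha>"
  obtain \<phi> where iso: "isomorphism ?E \<alpha>e \<phi>" and \<phi>j: "\<And>x. x \<in> pcarrier \<alpha> \<Longrightarrow> \<phi> (?j x) = \<iota> x"
    using universal_pair_isomorphism[OF universal_pair_envelope[OF \<alpha>] universal_pair_envelope[OF \<alpha>] u e]
    by blast
  note \<iota> = universal_pairD[OF e]
  show "universal_pair TYPE('y) \<alpha> \<iota> \<alpha>e"
    using universal_pair_transfer[OF universal_pair_envelope[OF \<alpha>] iso \<phi>j \<iota>] .
  have hom: "homeomorphic_map (pspace ?E) (pspace \<alpha>e) \<phi>"
    by (rule isomorphism_imp_homeomorphic_map[OF iso])
  \<comment> \<open>On the carrier \<open>\<iota>\<close> is this composite, so it inherits openness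
    from the canonical map and the homeomorphism \<open>\<phi>\<close>.\<close>
  have "open_map (pspace \<alpha>) (pspace \<alpha>e) (\<phi> \<circ> ?j)"
    by (rule open_map_compose[OF open_map_unit_map[OF \<alpha>] homeomorphic_imp_open_map[OF hom]])
  then have om: "open_map (pspace \<alpha>) (pspace \<alpha>e) \<iota>"
    by (rule open_map_eq) (simp add: \<phi>j)
  then show "openin (pspace \<alpha>e) (\<iota> ` pcarrier \<alpha>)"
    by (simp add: open_map_def)
  have j: "?j x \<in> pcarrier ?E" if "x \<in> pcarrier \<alpha>" for x
    using morphism_mem[OF morphism_unit_map[OF \<alpha>] that] .
  have "inj_on \<iota> (pcarrier \<alpha>)"
    using homeomorphic_imp_injective_map[OF hom] inj_on_unit_map[OF \<alpha>] j \<phi>j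
    unfolding inj_on_def by metis
  moreover have "continuous_map (pspace \<alpha>) (pspace \<alpha>e) \<iota>"
    using \<iota>(2) by (simp add: morphism_def)
  ultimately show "homeomorphic_map (pspace \<alpha>) (subtopology (pspace \<alpha>e) (\<iota> ` pcarrier \<alpha>)) \<iota>"
    using injective_open_imp_embedding_map[OF _ om] by (simp add: embedding_map_def)
  \<comment> \<open>Equivariance of \<open>\<phi>\<close> matches the translates of the two copies
    of \<open>X\<close>, so surjectivity of \<open>\<phi>\<close> turns the orbit of one into the
    orbit of the other.\<close>
  have "\<phi> (pmap ?E t (?j x)) = pmap \<alpha>e t (\<iota> x)" if "x \<in> pcarrier \<alpha>" for t x
    using iso morphism_equivariant[of ?E \<alpha>e \<phi> "?j x" t] j[OF that] \<phi>j[OF that]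
    by (simp add: isomorphism_def pdom_envelope)
  then have "\<phi> ` (pmap ?E t ` (?j ` pcarrier \<alpha>)) = pmap \<alpha>e t ` (\<iota> ` pcarrier \<alpha>)" for t
    by (force simp: image_image)
  then have "\<phi> ` pcarrier ?E = (\<Union>t. pmap \<alpha>e t ` (\<iota> ` pcarrier \<alpha>))"
    unfolding orbit_unit_map by (simp add: image_UN)
  then show "pcarrier \<alpha>e = (\<Union>t. pmap \<alpha>e t ` (\<iota> ` pcarrier \<alpha>))"
    using homeomorphic_imp_surjective_map[OF hom] by simp
qed

theorem theorem2p5:
  fixes \<alpha> :: "('g::topological_group_add, 'x) paction"
  assumes "partial_action \<alpha>"
  shows
    \<comment> \<open>existence: \<open>'y\<close> is arbitrary, and \<open>('g \<times> 'x) set\<close> is a fixed type carrying the quotient of \<open>G \<times> X\<close>\<close>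
    "(\<exists>(\<iota> :: 'x \<Rightarrow> ('g \<times> 'x) set) (\<alpha>e :: ('g, ('g \<times> 'x) set) paction).
        universal_pair TYPE(('g \<times> 'x) set) \<alpha> \<iota> \<alpha>e \<and> universal_pair TYPE('y) \<alpha> \<iota> \<alpha>e)
     \<comment> \<open>every such pair is universal for all \<open>'y\<close>, so that the pair above can be chosen
         independently of \<open>'y\<close>; and it is an open embedding whose orbit is everything\<close>
   \<and> (\<forall>(\<iota> :: 'x \<Rightarrow> 'e) (\<alpha>e :: ('g, 'e) paction).
        universal_pair TYPE(('g \<times> 'x) set) \<alpha> \<iota> \<alpha>e \<and> universal_pair TYPE('e) \<alpha> \<iota> \<alpha>e \<longrightarrow>
        universal_pair TYPE('y) \<alpha> \<iota> \<alpha>e \<and>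
        openin (pspace \<alpha>e) (\<iota> ` pcarrier \<alpha>) \<and>
        homeomorphic_map (pspace \<alpha>) (subtopology (pspace \<alpha>e) (\<iota> ` pcarrier \<alpha>)) \<iota> \<and>
        pcarrier \<alpha>e = (\<Union>t. pmap \<alpha>e t ` (\<iota> ` pcarrier \<alpha>)))
     \<comment> \<open>uniqueness up to canonical isomorphism\<close>
   \<and> (\<forall>(\<iota> :: 'x \<Rightarrow> 'e) (\<alpha>e :: ('g, 'e) paction) (\<iota>' :: 'x \<Rightarrow> 'f) (\<alpha>e' :: ('g, 'f) paction).
        universal_pair TYPE('e) \<alpha> \<iota> \<alpha>e \<and> universal_pair TYPE('f) \<alpha> \<iota> \<alpha>e \<and>
        universal_pair TYPE('e) \<alpha> \<iota>' \<alpha>e' \<and> universal_pair TYPE('f) \<alpha> \<iota>' \<alpha>e' \<longrightarrow>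
        (\<exists>\<phi>. isomorphism \<alpha>e \<alpha>e' \<phi> \<and> (\<forall>x \<in> pcarrier \<alpha>. \<phi> (\<iota> x) = \<iota>' x) \<and>
           (\<forall>\<eta>. morphism \<alpha>e \<alpha>e' \<eta> \<and> (\<forall>x \<in> pcarrier \<alpha>. \<eta> (\<iota> x) = \<iota>' x) \<longrightarrow>
              (\<forall>z \<in> pcarrier \<alpha>e. \<eta> z = \<phi> z))))"
proof (intro conjI allI impI, goal_cases)
  case 1
  \<comment> \<open>One witness serves both test types, because the envelope does not depend on
    \<open>'y\<close>.\<close>
  show ?case
    by (rule exI[of _ "unit_map \<alpha>"], rule exI[of _ "envelope \<alpha>"])
      (intro conjI universal_pair_envelope[OF assms])
next
  case (2 \<iota> \<alpha>e)
  then show ?case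
    by (auto intro: universal_pair_open_embedding(1)[OF assms])
next
  case (3 \<iota> \<alpha>e)
  then show ?case
    using universal_pair_open_embedding(2)[OF assms] by blast
next
  case (4 \<iota> \<alpha>e)
  then show ?case
    using universal_pair_open_embedding(3)[OF assms] by blast
next
  case (5 \<iota> \<alpha>e)
  then show ?case
    by (elim conjE) (rule universal_pair_open_embedding(4)[OF assms])
next
  case (6 \<iota> \<alpha>e \<iota>' \<alpha>e')
  then obtain \<phi> where \<phi>: "isomorphism \<alpha>e \<alpha>e' \<phi>" "\<And>x. x \<in> pcarrier \<alpha> \<Longrightarrow> \<phi> (\<iota> x) = \<iota>' x"
    using universal_pair_isomorphism by metis
  \<comment> \<open>The isomorphism is canonical: it is the only morphism compatible with both maps
    from \<open>X\<close>, by universality of \<open>\<alpha>e\<close> against the type of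
    \<open>\<alpha>e'\<close>.\<close>
  have "\<eta> z = \<phi> z"
    if "morphism \<alpha>e \<alpha>e' \<eta>" "\<forall>x \<in> pcarrier \<alpha>. \<eta> (\<iota> x) = \<iota>' x" "z \<in> pcarrier \<alpha>e" for \<eta> z
  proof (rule universal_pair_unique[OF _ _ that(1) _ _ that(3)])
    show "universal_pair TYPE('f) \<alpha> \<iota> \<alpha>e" "global_action \<alpha>e'" "morphism \<alpha>e \<alpha>e' \<phi>"
      using 6 \<phi>(1) universal_pairD(1) by (auto simp: isomorphism_def)
  qed (use that(2) \<phi>(2) in simp)
  with \<phi> show ?case
    by blast
qed

end
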